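(* Suppose $H$ is a subgroup of $PL_o(I)$ with orbital $A$. If $H$ has an element $h$ which has one orbital sharing exactly one end with $A$, while the other orbitals of $h$ do not share an end with $A$, then $H$ admits a transition chain of length two.
   Context: $I=[0,1]$. $PL_o(I)$ is the group, under composition, of orientation-preserving piecewise-linear homeomorphisms of $I$ with finitely many breaks in slope. Elements act on the right. An orbital of a subgroup $G\le PL_o(I)$ is the convex hull of the orbit of a point of $I$ under $G$, provided this set has more than one element; orbitals are open intervals. An orbital of an element $g$ is an orbital of $\langle g\rangle$. A signed orbital of $G$ is a pair $(A,g)$ with $g\in G$ and $A$ an orbital of $g$. If $A=(a,b)$ is an orbital of $G$ and $B=(c,d)$ is an orbital of an element $g\in G$, then $B$ shares an end with $A$ if $c=a$ or $d=b$ (it shares exactly one end if exactly one of these equalities holds). $G$ admits a transition chain of length two if it has two signed orbitals $(A,g)$, $(B,h)$ with $A=(a_1,a_2)$, $B=(b_1,b_2)$ and $a_1<b_1<a_2<b_2$. *)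

theory Defs
  imports "HOL-Analysis.Analysis" "HOL-Algebra.Generated_Groups"
begin

text \<open>
  All breaks in slope lie in a finite set \<open>S\<close>.  The affine formula is required on the closed
  interval \<open>{u..v}\<close>; the notion is only used for continuous functions, where this is no
  restriction.
\<close>

definition piecewise_linear_on :: "real set \<Rightarrow> (real \<Rightarrow> real) \<Rightarrow> bool" where
  "piecewise_linear_on I f \<longleftrightarrow>
     (\<exists>S. finite S \<and>
        (\<forall>u v. u < v \<and> {u..v} \<subseteq> I \<and> {u<..<v} \<inter> S = {} \<longrightarrow>
           (\<exists>m c. \<forall>x\<in>{u..v}. f x = m * x + c)))"

text \<open>
  A homeomorphism of the unit interval is represented by its extension by the identity to all
  reals, so that equality of representatives is equality of homeomorphisms.  Elements act on the
  right, so the product of \<open>f\<close> and \<open>g\<close> is "first \<open>f\<close>, then \<open>g\<close>".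
\<close>

definition PLo :: "(real \<Rightarrow> real) monoid" where
  "PLo =
     \<lparr>carrier = {f. (\<exists>g. homeomorphism {0..1} {0..1} f g) \<and> strict_mono_on {0..1} f \<and>
                    piecewise_linear_on {0..1} f \<and> (\<forall>x. x \<notin> {0..1} \<longrightarrow> f x = x)},
      monoid.mult = (\<lambda>f g. g \<circ> f),
      one = id\<rparr>"

definition orbit_of :: "(real \<Rightarrow> real) set \<Rightarrow> real \<Rightarrow> real set" where
  "orbit_of G x = (\<lambda>g. g x) ` G"

definition orbital :: "(real \<Rightarrow> real) set \<Rightarrow> real set \<Rightarrow> bool" where
  "orbital G A \<longleftrightarrow>
     (\<exists>x\<in>{0..1}. A = convex hull (orbit_of G x) \<and> (\<exists>y\<in>A. \<exists>z\<in>A. y \<noteq> z))"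

definition element_orbital :: "(real \<Rightarrow> real) \<Rightarrow> real set \<Rightarrow> bool" where
  "element_orbital g A \<longleftrightarrow> orbital (generate PLo {g}) A"

definition signed_orbitals :: "(real \<Rightarrow> real) set \<Rightarrow> (real set \<times> (real \<Rightarrow> real)) set" where
  "signed_orbitals G = {(A, g). g \<in> G \<and> element_orbital g A}"

text \<open>The conditions \<open>a < b\<close> and \<open>c < d\<close> make the ends of the intervals well defined.\<close>

definition shares_end :: "real set \<Rightarrow> real set \<Rightarrow> bool" where
  "shares_end B A \<longleftrightarrow>
     (\<exists>a b c d. a < b \<and> c < d \<and> A = {a<..<b} \<and> B = {c<..<d} \<and> (c = a \<or> d = b))"

definition shares_exactly_one_end :: "real set \<Rightarrow> real set \<Rightarrow> bool" where
  "shares_exactly_one_end B A \<longleftrightarrow>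
     (\<exists>a b c d. a < b \<and> c < d \<and> A = {a<..<b} \<and> B = {c<..<d} \<and>
        (c = a \<and> d \<noteq> b \<or> c \<noteq> a \<and> d = b))"

definition admits_transition_chain_of_length_two :: "(real \<Rightarrow> real) set \<Rightarrow> bool" where
  "admits_transition_chain_of_length_two G \<longleftrightarrow>
     (\<exists>a1 a2 b1 b2 g h.
        ({a1<..<a2}, g) \<in> signed_orbitals G \<and> ({b1<..<b2}, h) \<in> signed_orbitals G \<and>
        a1 < b1 \<and> b1 < a2 \<and> a2 < b2)"

lemma PLo_mult: "f \<otimes>\<^bsub>PLo\<^esub> g = g \<circ> f" and PLo_one: "\<one>\<^bsub>PLo\<^esub> = id"
  by (simp_all add: PLo_def)

lemma PLo_image: "f \<in> carrier PLo \<Longrightarrow> f ` {0..1} = {0..1}"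
  by (auto simp: PLo_def homeomorphism_def)

lemma PLo_betweenE:
  assumes f: "f \<in> carrier PLo" and uv: "u \<in> {0..1}" "v \<in> {0..1}" "f u < y" "y < f v"
  obtains x where "u < x" "x < v" "y = f x"
proof -
  have sm: "strict_mono_on {0..1} f" using f by (simp add: PLo_def)
  have "f u \<in> {0..1}" "f v \<in> {0..1}" using PLo_image[OF f] uv by blast+
  then have "y \<in> f ` {0..1}" using PLo_image[OF f] uv by auto
  then obtain x where x: "x \<in> {0..1}" "y = f x" by blast
  then show thesis
    using that uv strict_mono_on_less[OF sm uv(1) x(1)] strict_mono_on_less[OF sm x(1) uv(2)] by simp
qed

lemma PLo_comp:
  assumes f: "f \<in> carrier PLo" and g: "g \<in> carrier PLo"
  shows "g \<circ> f \<in> carrier PLo"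
proof -
  from f g obtain f' g' where h: "homeomorphism {0..1} {0..1} f f'" "homeomorphism {0..1} {0..1} g g'"
    by (auto simp: PLo_def)
  have smf: "strict_mono_on {0..1} f" and smg: "strict_mono_on {0..1} g"
    using f g by (simp_all add: PLo_def)
  have im: "f ` {0..1} = {0..1}" by (rule PLo_image[OF f])
  obtain S where S: "finite S"
    "\<And>u v. u < v \<Longrightarrow> {u..v} \<subseteq> {0..1} \<Longrightarrow> {u<..<v} \<inter> S = {} \<Longrightarrow> \<exists>m c. \<forall>x\<in>{u..v}. f x = m * x + c"
    using f by (auto simp: PLo_def piecewise_linear_on_def)
  obtain T where T: "finite T"
    "\<And>u v. u < v \<Longrightarrow> {u..v} \<subseteq> {0..1} \<Longrightarrow> {u<..<v} \<inter> T = {} \<Longrightarrow> \<exists>m c. \<forall>x\<in>{u..v}. g x = m * x + c"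
    using g by (auto simp: PLo_def piecewise_linear_on_def)
  let ?U = "S \<union> (f -` T \<inter> {0..1})"
  have "finite ?U"
    using S(1) T(1) strict_mono_on_imp_inj_on[OF smf] by (simp add: finite_vimage_IntI)
  moreover have "\<exists>m c. \<forall>x\<in>{u..v}. (g \<circ> f) x = m * x + c"
    if uv: "u < v" "{u..v} \<subseteq> {0..1}" "{u<..<v} \<inter> ?U = {}" for u v
  proof -
    have uvI: "u \<in> {0..1}" "v \<in> {0..1}" using uv by auto
    obtain m c where mc: "\<And>x. x \<in> {u..v} \<Longrightarrow> f x = m * x + c" using S(2)[of u v] uv by blast
    have lt: "f u < f v" using smf uv(1) uvI by (simp add: strict_mono_on_less)
    have "f u \<in> {0..1}" "f v \<in> {0..1}" using im uvI by blast+
    moreover have "{f u<..<f v} \<inter> T = {}"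
    proof (rule ccontr)
      assume "\<not> ?thesis"
      then obtain y where y: "f u < y" "y < f v" "y \<in> T" by auto
      obtain x where "u < x" "x < v" "y = f x" by (rule PLo_betweenE[OF f uvI y(1,2)])
      then have "x \<in> {u<..<v} \<inter> ?U" using y uvI by auto
      then show False using uv(3) by blast
    qed
    ultimately obtain n d where nd: "\<And>y. y \<in> {f u..f v} \<Longrightarrow> g y = n * y + d"
      using T(2)[OF lt] by auto
    have "(g \<circ> f) x = (n * m) * x + (n * c + d)" if x: "x \<in> {u..v}" for x
    proof -
      have "x \<in> {0..1}" using x uv(2) by blast
      then have "f x \<in> {f u..f v}" using x uvI smf by (auto simp: strict_mono_on_less_eq)
      then have "g (f x) = n * f x + d" by (rule nd)
      then show ?thesis unfolding mc[OF x] by (simp add: mc[OF x] algebra_simps)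
    qed
    then show ?thesis by blast
  qed
  ultimately have "piecewise_linear_on {0..1} (g \<circ> f)"
    unfolding piecewise_linear_on_def by (intro exI[of _ ?U]) simp
  moreover have "strict_mono_on {0..1} (g \<circ> f)"
  proof (rule strict_mono_onI)
    fix r s :: real assume rs: "r \<in> {0..1}" "s \<in> {0..1}" "r < s"
    have "f r \<in> {0..1}" "f s \<in> {0..1}" using im rs by blast+
    then show "(g \<circ> f) r < (g \<circ> f) s"
      using rs smf smg by (simp add: strict_mono_on_less)
  qed
  moreover have "\<exists>k. homeomorphism {0..1} {0..1} (g \<circ> f) k"
    using homeomorphism_compose[OF h] by blast
  ultimately show ?thesis using f g by (auto simp: PLo_def)
qed

lemma PLo_left_inverse:
  assumes f: "f \<in> carrier PLo"
  shows "\<exists>k\<in>carrier PLo. f \<circ> k = id"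
proof -
  obtain f' where h: "homeomorphism {0..1} {0..1} f f'" using f by (auto simp: PLo_def)
  have smf: "strict_mono_on {0..1} f" using f by (simp add: PLo_def)
  define k where "k = (\<lambda>x. if x \<in> {0..1} then f' x else x)"
  have kI: "k ` {0..1} = {0..1}" using h by (force simp: k_def homeomorphism_def)
  have fk: "f (k x) = x" for x using h f by (auto simp: k_def homeomorphism_def PLo_def)
  have smk: "strict_mono_on {0..1} k"
  proof (rule strict_mono_onI)
    fix r s :: real assume rs: "r \<in> {0..1}" "s \<in> {0..1}" "r < s"
    have "k r \<in> {0..1}" "k s \<in> {0..1}" using kI rs by blast+
    then show "k r < k s" using strict_mono_on_less[OF smf, of "k r" "k s"] rs fk by simp
  qed
  have hk: "homeomorphism {0..1} {0..1} k f"
    using homeomorphism_symD[OF h] by (rule homeomorphism_cong) (auto simp: k_def)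
  obtain S where S: "finite S"
    "\<And>u v. u < v \<Longrightarrow> {u..v} \<subseteq> {0..1} \<Longrightarrow> {u<..<v} \<inter> S = {} \<Longrightarrow> \<exists>m c. \<forall>x\<in>{u..v}. f x = m * x + c"
    using f by (auto simp: PLo_def piecewise_linear_on_def)
  have "\<exists>m c. \<forall>y\<in>{u..v}. k y = m * y + c"
    if uv: "u < v" "{u..v} \<subseteq> {0..1}" "{u<..<v} \<inter> f ` S = {}" for u v
  proof -
    have uvI: "u \<in> {0..1}" "v \<in> {0..1}" using uv by auto
    have ku: "k u \<in> {0..1}" "k v \<in> {0..1}" using kI uvI by blast+
    have lt: "k u < k v" using smk uv(1) uvI by (simp add: strict_mono_on_less)
    have "{k u<..<k v} \<inter> S = {}"
    proof (rule ccontr)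
      assume "\<not> ?thesis"
      then obtain x where x: "k u < x" "x < k v" "x \<in> S" by auto
      then have "x \<in> {0..1}" using ku by auto
      then have "u < f x" "f x < v"
        using x ku strict_mono_on_less[OF smf, of "k u" x] strict_mono_on_less[OF smf, of x "k v"] fk
        by auto
      then show False using x uv(3) by auto
    qed
    then obtain m c where mc: "\<And>x. x \<in> {k u..k v} \<Longrightarrow> f x = m * x + c"
      using S(2)[OF lt] ku by auto
    have "u = m * k u + c" "v = m * k v + c" using mc[of "k u"] mc[of "k v"] fk lt by simp_all
    then have "m \<noteq> 0" using uv(1) by (metis less_irrefl mult_zero_left)
    have "k y = (1 / m) * y + (- c / m)" if y: "y \<in> {u..v}" for y
    proof -
      have "y \<in> {0..1}" using y uv(2) by blast
      then have "k y \<in> {k u..k v}" using y uvI smk by (auto simp: strict_mono_on_less_eq)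
      then have "y = m * k y + c" using mc[of "k y"] fk[of y] by simp
      then show ?thesis using \<open>m \<noteq> 0\<close> by (simp add: field_simps)
    qed
    then show ?thesis by blast
  qed
  then have "piecewise_linear_on {0..1} k"
    unfolding piecewise_linear_on_def using S(1) by (intro exI[of _ "f ` S"]) auto
  then have "k \<in> carrier PLo" using hk smk by (auto simp: PLo_def k_def)
  then show ?thesis using fk by (auto simp: fun_eq_iff)
qed

lemma PLo_id: "id \<in> carrier PLo"
proof -
  have "\<exists>g. homeomorphism {0..1::real} {0..1} id g"
    using homeomorphism_ident[of "{0..1::real}"] unfolding id_def by blast
  moreover have "piecewise_linear_on {0..1} id"
    unfolding piecewise_linear_on_def
  proof (intro exI[of _ "{}"] conjI allI impI)
    show "\<exists>m c. \<forall>x\<in>{u..v}. id x = m * x + c" for u v :: real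
      by (rule exI[of _ 1], rule exI[of _ 0]) simp
  qed simp
  ultimately show ?thesis by (auto simp: PLo_def strict_mono_on_def)
qed

lemma group_PLo: "group PLo"
proof (rule groupI)
  fix f assume "f \<in> carrier PLo"
  then show "\<exists>k\<in>carrier PLo. k \<otimes>\<^bsub>PLo\<^esub> f = \<one>\<^bsub>PLo\<^esub>"
    using PLo_left_inverse by (simp add: PLo_mult PLo_one)
qed (simp_all add: PLo_mult PLo_one PLo_comp PLo_id comp_assoc)

end

theory Submission imports Defs begin

text \<open>
  Say \<open>A = (a, b)\<close> and \<open>h\<close> has the orbital \<open>(a, d)\<close> with \<open>d < b\<close>.  The group \<open>H\<close> does not fix
  \<open>d\<close>, so some \<open>k \<in> H\<close> moves \<open>d\<close> to the right.  The germs of \<open>h\<close> and \<open>k\<close> at their common fixed point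
  \<open>a\<close> are linear and hence commute, so the commutator of \<open>h\<close> and \<open>k\<close> has fixed points
  arbitrarily close to \<open>a\<close>; but it moves \<open>d\<close>, because the conjugate of \<open>h\<close> by \<open>k\<close> has the
  orbital \<open>(a, k d)\<close>, which contains \<open>d\<close>.  Its orbital around \<open>d\<close> therefore forms a transition chain with
  \<open>(a, d)\<close>.  The case of a common right end is symmetric.
\<close>

section \<open>Elements as increasing, locally affine maps of the real line\<close>

lemma PLo_mem_unit_interval: "f \<in> carrier PLo \<Longrightarrow> x \<in> {0..1} \<Longrightarrow> f x \<in> {0..1}"
  using PLo_image by blast

text \<open>Inside and outside the unit interval do not mix, since \<open>f\<close> preserves the
  interval and is the identity elsewhere. Later comparisons can therefore be made on the whole
  line.\<close>

lemma PLo_strict_mono: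
  assumes f: "f \<in> carrier PLo"
  shows "strict_mono f"
proof (rule strict_monoI)
  fix x y :: real assume xy: "x < y"
  have sm: "strict_mono_on {0..1} f" and out: "\<And>x. x \<notin> {0..1} \<Longrightarrow> f x = x"
    using f by (auto simp: PLo_def)
  consider "x \<in> {0..1}" "y \<in> {0..1}" | "x \<in> {0..1}" "y \<notin> {0..1}"
    | "x \<notin> {0..1}" "y \<in> {0..1}" | "x \<notin> {0..1}" "y \<notin> {0..1}" by blast
  then show "f x < f y"
  proof cases
    case 1 then show ?thesis using sm xy by (simp add: strict_mono_on_less)
  next
    case 2 then show ?thesis using PLo_mem_unit_interval[OF f 2(1)] out[OF 2(2)] xy by auto
  next
    case 3 then show ?thesis using PLo_mem_unit_interval[OF f 3(2)] out[OF 3(1)] xy by auto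
  next
    case 4 then show ?thesis using out xy by simp
  qed
qed

lemma PLo_less_iff: "f \<in> carrier PLo \<Longrightarrow> f x < f y \<longleftrightarrow> x < y"
  using PLo_strict_mono strict_mono_less by blast

lemma PLo_affine_right:
  assumes f: "f \<in> carrier PLo" and a: "0 \<le> a" "a < 1"
  obtains t m c where "a < t" "\<And>x. x \<in> {a..t} \<Longrightarrow> f x = m * x + c"
proof -
  obtain S where S: "finite S"
    "\<And>u v. u < v \<Longrightarrow> {u..v} \<subseteq> {0..1} \<Longrightarrow> {u<..<v} \<inter> S = {} \<Longrightarrow> \<exists>m c. \<forall>x\<in>{u..v}. f x = m * x + c"
    using f by (auto simp: PLo_def piecewise_linear_on_def)
  \<comment> \<open>The next break to the right of \<open>a\<close>; the added \<open>1\<close>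
    makes the minimum exist and keeps it inside the unit interval.\<close>
  define T where "T = insert 1 (S \<inter> {a<..})"
  have T: "finite T" "T \<noteq> {}" using S(1) by (auto simp: T_def)
  have "a < Min T" using T a by (auto simp: T_def)
  moreover have "Min T \<le> 1" using T by (auto simp: T_def)
  moreover have "{a<..<Min T} \<inter> S = {}"
    using Min_le[OF T(1)] by (fastforce simp: T_def)
  ultimately show thesis using S(2)[of a "Min T"] a that by auto
qed

lemma PLo_affine_left:
  assumes f: "f \<in> carrier PLo" and b: "0 < b" "b \<le> 1"
  obtains t m c where "t < b" "\<And>x. x \<in> {t..b} \<Longrightarrow> f x = m * x + c"
proof -
  obtain S where S: "finite S"
    "\<And>u v. u < v \<Longrightarrow> {u..v} \<subseteq> {0..1} \<Longrightarrow> {u<..<v} \<inter> S = {} \<Longrightarrow> \<exists>m c. \<forall>x\<in>{u..v}. f x = m * x + c"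
    using f by (auto simp: PLo_def piecewise_linear_on_def)
  define T where "T = insert 0 (S \<inter> {..<b})"
  have T: "finite T" "T \<noteq> {}" using S(1) by (auto simp: T_def)
  have "Max T < b" using T b by (auto simp: T_def)
  moreover have "0 \<le> Max T" using T by (auto simp: T_def)
  moreover have "{Max T<..<b} \<inter> S = {}"
    using Max_ge[OF T(1)] by (fastforce simp: T_def)
  ultimately show thesis using S(2)[of "Max T" b] b that by auto
qed

text \<open>With \<open>p\<close> as origin both maps are multiplications by their slopes, and these
  commute. The images of \<open>w\<close> must lie in \<open>S\<close> so that the affine formulas
  apply a second time.\<close>

lemma affine_common_fixpoint_commute:
  fixes f g :: "real \<Rightarrow> real"
  assumes "\<And>x. x \<in> S \<Longrightarrow> f x = m * x + c" "\<And>x. x \<in> S \<Longrightarrow> g x = n * x + e"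
    and "p \<in> S" "f p = p" "g p = p" and "w \<in> S" "f w \<in> S" "g w \<in> S"
  shows "f (g w) = g (f w)"
proof -
  have "p = m * p + c" "p = n * p + e" using assms by metis+
  then have c: "c = p - m * p" and e: "e = p - n * p" by auto
  have "f (g w) = m * (n * w + e) + c" "g (f w) = n * (m * w + c) + e"
    using assms by simp_all
  then show ?thesis unfolding c e by (simp add: algebra_simps)
qed

section \<open>Subgroups and their orbitals\<close>

lemma PLo_subgroup_compose: "subgroup G PLo \<Longrightarrow> f \<in> G \<Longrightarrow> g \<in> G \<Longrightarrow> g \<circ> f \<in> G"
  using subgroup.m_closed PLo_mult by fastforce

lemma PLo_subgroup_inverse:
  assumes "subgroup G PLo" "g \<in> G"
  shows "\<exists>g'\<in>G. (\<forall>x. g' (g x) = x) \<and> (\<forall>x. g (g' x) = x)"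
proof -
  have g: "g \<in> carrier PLo" using assms subgroup.mem_carrier by fast
  let ?i = "inv\<^bsub>PLo\<^esub> g"
  have "?i \<circ> g = id" "g \<circ> ?i = id"
    using group.r_inv[OF group_PLo g] group.l_inv[OF group_PLo g]
    by (simp_all add: PLo_mult PLo_one)
  then show ?thesis
    using subgroup.m_inv_closed[OF assms] by (intro bexI[of _ ?i]) (simp_all add: fun_eq_iff)
qed

text \<open>By monotonicity, \<open>g\<close> and its inverse move \<open>y\<close> in opposite
  directions.\<close>

lemma PLo_subgroup_moves_both_ways:
  assumes "subgroup G PLo" "g \<in> G" "g y \<noteq> y"
  shows "\<exists>k\<in>G. y < k y" "\<exists>k\<in>G. k y < y"
proof -
  obtain g' where g': "g' \<in> G" "\<And>x. g' (g x) = x" "\<And>x. g (g' x) = x"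
    using PLo_subgroup_inverse[OF assms(1,2)] by metis
  have "g' \<in> carrier PLo" using assms(1) g'(1) subgroup.mem_carrier by fast
  then have "g' y < y \<longleftrightarrow> y < g y" "y < g' y \<longleftrightarrow> g y < y"
    using PLo_less_iff[of g' y "g y"] PLo_less_iff[of g' "g y" y] g'(2) by simp_all
  then show "\<exists>k\<in>G. y < k y" "\<exists>k\<in>G. k y < y"
    using assms g'(1) by (metis linorder_neqE)+
qed

text \<open>Every orbit point is moved both ways, so the orbit has neither a least nor a greatest
  element and its hull is the open interval between infimum and supremum. Invariance of the orbit
  makes these ends fixed.\<close>

lemma orbital_interval:
  assumes G: "subgroup G PLo" and A: "orbital G A"
  obtains a b where "A = {a<..<b}" "a < b" "0 \<le> a" "b \<le> 1"
    "\<And>g. g \<in> G \<Longrightarrow> g a = a" "\<And>g. g \<in> G \<Longrightarrow> g b = b"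
    "\<And>y. y \<in> A \<Longrightarrow> \<exists>g\<in>G. g y \<noteq> y"
proof -
  obtain x p q where x: "x \<in> {0..1}" "A = convex hull (orbit_of G x)" "p \<in> A" "q \<in> A" "p \<noteq> q"
    using A unfolding orbital_def by blast
  define U where "U = orbit_of G x"
  have carr: "g \<in> carrier PLo" if "g \<in> G" for g using G that subgroup.mem_carrier by fast
  have idG: "id \<in> G" using subgroup.one_closed[OF G] by (simp add: PLo_one)
  have xU: "x \<in> U" unfolding U_def orbit_of_def using idG by (metis id_apply image_eqI)
  have stab: "g y \<in> U" if "g \<in> G" "y \<in> U" for g y
  proof -
    obtain k where "k \<in> G" "y = k x" using \<open>y \<in> U\<close> by (auto simp: U_def orbit_of_def)
    then have "g \<circ> k \<in> G" "g y = (g \<circ> k) x" using PLo_subgroup_compose[OF G _ \<open>g \<in> G\<close>] by simp_all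
    then show ?thesis unfolding U_def orbit_of_def by blast
  qed
  have U01: "U \<subseteq> {0..1}" using PLo_mem_unit_interval[OF carr x(1)] by (auto simp: U_def orbit_of_def)
  have bdd: "bdd_above U" "bdd_below U" using U01 by (meson bdd_above_Icc bdd_below_Icc bdd_above_mono bdd_below_mono)+
  have moved: "\<exists>g\<in>G. g y \<noteq> y" if y: "y \<in> U" for y
  proof (rule ccontr)
    assume fixed: "\<not> ?thesis"
    obtain k where k: "k \<in> G" "y = k x" using y by (auto simp: U_def orbit_of_def)
    obtain k' where k': "k' \<in> G" "\<And>x. k' (k x) = x" using PLo_subgroup_inverse[OF G k(1)] by metis
    \<comment> \<open>Since \<open>k\<close> fixes \<open>y\<close>, injectivity of \<open>k\<close>
      and \<open>k x = y\<close> give \<open>x = y\<close>. The orbit is then a single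
      point.\<close>
    have yx: "y = x" using fixed k k' by metis
    have "U = {x}" using fixed idG yx xU by (auto simp: U_def orbit_of_def)
    then show False using x by (simp add: U_def)
  qed
  have up: "\<exists>z\<in>U. y < z" and down: "\<exists>z\<in>U. z < y" if "y \<in> U" for y
    using moved[OF that] PLo_subgroup_moves_both_ways[OF G, of _ y] stab that by blast+
  define a b where "a = Inf U" and "b = Sup U"
  have ltb: "y < b" and lta: "a < y" if "y \<in> U" for y
    using up[OF that] down[OF that] bdd unfolding a_def b_def
    by (meson cSup_upper cInf_lower less_le_trans le_less_trans)+
  have nearb: "\<exists>y\<in>U. z < y" if "z < b" for z
    using that xU bdd less_cSup_iff[of U z] unfolding b_def by blast
  have neara: "\<exists>y\<in>U. y < z" if "a < z" for z
    using that xU bdd cInf_less_iff[of U z] unfolding a_def by blast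
  have A_eq: "A = {a<..<b}"
  proof
    show "A \<subseteq> {a<..<b}" unfolding x(2) U_def[symmetric]
      by (rule hull_minimal) (use ltb lta in auto)
    show "{a<..<b} \<subseteq> A"
    proof
      fix z assume "z \<in> {a<..<b}"
      then obtain u v where "u \<in> U" "v \<in> U" "u < z" "z < v" using neara nearb by fastforce
      moreover from this have "u \<in> A" "v \<in> A" using hull_inc unfolding x(2) U_def by fastforce+
      moreover have "is_interval A" using x(2) by (simp add: is_interval_convex_1)
      ultimately show "z \<in> A" by (meson is_interval_1 less_imp_le)
    qed
  qed
  have fixab: "g a = a" "g b = b" if g: "g \<in> G" for g
  proof -
    show "g b = b"
    proof (rule ccontr)
      assume "g b \<noteq> b"
      then obtain k where k: "k \<in> G" "k b < b"
        using PLo_subgroup_moves_both_ways[OF G g] by blast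
      \<comment> \<open>An orbit point above \<open>k b\<close> is sent by the inverse of
        \<open>k\<close> to an orbit point above the supremum \<open>b\<close>.\<close>
      then obtain y where y: "y \<in> U" "k b < y" using nearb by blast
      obtain k' where k': "k' \<in> G" "\<And>x. k' (k x) = x" using PLo_subgroup_inverse[OF G k(1)] by metis
      have "b < k' y" using PLo_less_iff[OF carr[OF k'(1)], of "k b" y] k'(2) y(2) by simp
      then show False using ltb[OF stab[OF k'(1) y(1)]] by simp
    qed
    show "g a = a"
    proof (rule ccontr)
      assume "g a \<noteq> a"
      then obtain k where k: "k \<in> G" "a < k a"
        using PLo_subgroup_moves_both_ways[OF G g] by blast
      then obtain y where y: "y \<in> U" "y < k a" using neara by blast
      obtain k' where k': "k' \<in> G" "\<And>x. k' (k x) = x" using PLo_subgroup_inverse[OF G k(1)] by metis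
      have "k' y < a" using PLo_less_iff[OF carr[OF k'(1)], of y "k a"] k'(2) y(2) by simp
      then show False using lta[OF stab[OF k'(1) y(1)]] by simp
    qed
  qed
  have "\<exists>g\<in>G. g y \<noteq> y" if y: "y \<in> A" for y
  proof (rule ccontr)
    assume fixed: "\<not> ?thesis"
    \<comment> \<open>A point fixed by all of \<open>G\<close> keeps the orbit of \<open>x\<close>
      on one side, but \<open>A\<close> has orbit points on both sides of \<open>y\<close>.\<close>
    have side: "g x < y \<longleftrightarrow> x < y" "y < g x \<longleftrightarrow> y < x" if "g \<in> G" for g
      using PLo_less_iff[OF carr[OF that]] fixed that by metis+
    obtain u v where uv: "u \<in> U" "v \<in> U" "u < y" "y < v"
      using y neara nearb unfolding A_eq by fastforce
    then have "x < y" "y < x" using side by (auto simp: U_def orbit_of_def)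
    then show False by simp
  qed
  moreover have "a < b" using lta[OF xU] ltb[OF xU] by simp
  moreover have "0 \<le> a" unfolding a_def by (rule cInf_greatest) (use U01 xU in auto)
  moreover have "b \<le> 1" unfolding b_def by (rule cSup_least) (use U01 xU in auto)
  ultimately show thesis using that A_eq fixab by blast
qed

lemma orbital_fixes_ends:
  assumes "subgroup G PLo" "orbital G {a<..<b}" "a < b"
  shows "0 \<le> a" "b \<le> 1" "g \<in> G \<Longrightarrow> g a = a" "g \<in> G \<Longrightarrow> g b = b"
    and "a < y \<Longrightarrow> y < b \<Longrightarrow> \<exists>g\<in>G. g y \<noteq> y"
proof -
  obtain a' b' where *: "{a<..<b} = {a'<..<b'}" "a' < b'" "0 \<le> a'" "b' \<le> 1"
    "\<And>g. g \<in> G \<Longrightarrow> g a' = a'" "\<And>g. g \<in> G \<Longrightarrow> g b' = b'"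
    "\<And>y. y \<in> {a<..<b} \<Longrightarrow> \<exists>g\<in>G. g y \<noteq> y"
    using orbital_interval[OF assms(1,2)] by metis
  \<comment> \<open>A nonempty open interval determines its ends, as infimum and supremum.\<close>
  have "a' = a" "b' = b"
    using arg_cong[OF *(1), of Inf] arg_cong[OF *(1), of Sup] assms(3) *(2) by simp_all
  then show "0 \<le> a" "b \<le> 1" "g \<in> G \<Longrightarrow> g a = a" "g \<in> G \<Longrightarrow> g b = b"
    and "a < y \<Longrightarrow> y < b \<Longrightarrow> \<exists>g\<in>G. g y \<noteq> y"
    using * by auto
qed

section \<open>Orbitals of a single element\<close>

lemma generate_singleton_fixes:
  assumes g: "g \<in> carrier PLo" "g y = y" and k: "k \<in> generate PLo {g}"
  shows "k y = y"
  using k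
proof (induction rule: generate.induct)
  case one then show ?case by (simp add: PLo_one)
next
  case (incl k) then show ?case using g by simp
next
  case (inv k)
  have "inv\<^bsub>PLo\<^esub> g \<circ> g = id" using group.r_inv[OF group_PLo g(1)] by (simp add: PLo_mult PLo_one)
  then show ?case using inv g(2) by (metis comp_apply id_apply singletonD)
next
  case (eng k l) then show ?case by (simp add: PLo_mult)
qed

lemma subgroup_generate_singleton: "g \<in> carrier PLo \<Longrightarrow> subgroup (generate PLo {g}) PLo"
  using group.generate_is_subgroup[OF group_PLo] by simp

text \<open>A fixed point of \<open>g\<close> is fixed by the whole cyclic group, so none can lie
  inside an orbital.\<close>

lemma element_orbital_ends:
  assumes "g \<in> carrier PLo" "element_orbital g {c<..<d}" "c < d"
  shows "g c = c" "g d = d" "c < y \<Longrightarrow> y < d \<Longrightarrow> g y \<noteq> y"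
  using orbital_fixes_ends[OF subgroup_generate_singleton[OF assms(1)] _ assms(3)] assms(1,2)
    generate_singleton_fixes[OF assms(1)] generate.incl[of g "{g}" PLo]
  unfolding element_orbital_def by blast+

text \<open>The orbital is the hull of the orbit of \<open>x\<close>. Its last property serves to
  bound its ends by known fixed points of \<open>g\<close>.\<close>

lemma element_orbital_around_moved_point:
  assumes g: "g \<in> carrier PLo" and x: "x \<in> {0..1}" "g x \<noteq> x"
  obtains c e where "element_orbital g {c<..<e}" "c < x" "x < e"
    "\<And>p. g p = p \<Longrightarrow> p \<le> c \<or> e \<le> p"
proof -
  let ?G = "generate PLo {g}" and ?A = "convex hull (orbit_of (generate PLo {g}) x)"
  have "id \<in> ?G" "g \<in> ?G" using generate.one[of PLo "{g}"] generate.incl[of g "{g}" PLo] by (simp_all add: PLo_one)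
  then have "x \<in> orbit_of ?G x" "g x \<in> orbit_of ?G x"
    unfolding orbit_of_def by (metis id_apply image_eqI, blast)
  then have mem: "x \<in> ?A" "g x \<in> ?A" by (simp_all add: hull_inc)
  then have orb: "orbital ?G ?A" using x unfolding orbital_def by metis
  then obtain c e where ce: "?A = {c<..<e}" "c < e"
    using orbital_interval[OF subgroup_generate_singleton[OF g]] by metis
  have el: "element_orbital g {c<..<e}" using orb ce(1) unfolding element_orbital_def by simp
  show thesis
  proof (rule that[OF el])
    show "c < x" "x < e" using mem(1) unfolding ce(1) by auto
    show "p \<le> c \<or> e \<le> p" if "g p = p" for p
      using element_orbital_ends(3)[OF g el ce(2), of p] that by force
  qed
qed

section \<open>Commutators and commuting germs\<close>

lemma commutator_fixes_and_moves:
  assumes H: "subgroup H PLo" and "h \<in> H" "k \<in> H"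
    and "h d = d" "k z = d" "h z \<noteq> z" and "h (k w) = k (h w)"
  obtains g where "g \<in> H" "g d \<noteq> d" "g (h (k w)) = h (k w)"
proof -
  obtain h' where h': "h' \<in> H" "\<And>x. h' (h x) = x"
    using PLo_subgroup_inverse[OF H \<open>h \<in> H\<close>] by metis
  obtain k' where k': "k' \<in> H" "\<And>x. k' (k x) = x"
    using PLo_subgroup_inverse[OF H \<open>k \<in> H\<close>] by metis
  \<comment> \<open>The commutator applies \<open>h'\<close>, \<open>k'\<close>, \<open>h\<close>,
    \<open>k\<close> in this order. It takes \<open>d\<close> through \<open>d\<close>,
    \<open>z\<close>, \<open>h z\<close> to \<open>k (h z)\<close>, which differs from
    \<open>k z = d\<close>; it takes \<open>h (k w)\<close> through \<open>k w\<close>,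
    \<open>w\<close>, \<open>h w\<close> to \<open>k (h w) = h (k w)\<close>.\<close>
  have "k \<circ> (h \<circ> (k' \<circ> h')) \<in> H"
    using assms h' k' by (intro PLo_subgroup_compose[OF H])
  moreover have "(k \<circ> (h \<circ> (k' \<circ> h'))) d \<noteq> d"
    using assms h'(2)[of d] k'(2)[of z] k'(2)[of "h z"] by auto
  moreover have "(k \<circ> (h \<circ> (k' \<circ> h'))) (h (k w)) = h (k w)"
    by (simp add: h'(2) k'(2) assms(7)[symmetric])
  ultimately show thesis by (rule that)
qed

lemma PLo_commute_near_right:
  assumes H: "subgroup H PLo" and f: "f \<in> H" "f a = a" and g: "g \<in> H" "g a = a"
    and a: "0 \<le> a" "a < 1" "a < r"
  obtains w where "a < w" "w < r" "f (g w) = g (f w)"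
proof -
  have fc: "f \<in> carrier PLo" and gc: "g \<in> carrier PLo" using H f g subgroup.mem_carrier by fast+
  obtain t m c where t: "a < t" "\<And>x. x \<in> {a..t} \<Longrightarrow> f x = m * x + c"
    using PLo_affine_right[OF fc a(1,2)] by metis
  obtain s n e where s: "a < s" "\<And>x. x \<in> {a..s} \<Longrightarrow> g x = n * x + e"
    using PLo_affine_right[OF gc a(1,2)] by metis
  define v where "v = min t s"
  have v: "a < v" using t s by (simp add: v_def)
  obtain f' where f': "f' \<in> H" "\<And>x. f (f' x) = x" using PLo_subgroup_inverse[OF H f(1)] by metis
  obtain g' where g': "g' \<in> H" "\<And>x. g (g' x) = x" using PLo_subgroup_inverse[OF H g(1)] by metis
  \<comment> \<open>Below the preimages of \<open>v\<close>, the images under \<open>f\<close> and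
    \<open>g\<close> stay in the interval from \<open>a\<close> to \<open>v\<close> on which both
    maps are affine.\<close>
  have "a < f' v" "a < g' v"
    using PLo_less_iff[OF fc, of a "f' v"] PLo_less_iff[OF gc, of a "g' v"] f g f' g' v by simp_all
  then obtain w where w: "a < w" "w < min (min r v) (min (f' v) (g' v))"
    using dense[of a "min (min r v) (min (f' v) (g' v))"] a v by auto
  have "f w \<in> {a..v}"
    using PLo_less_iff[OF fc, of a w] PLo_less_iff[OF fc, of w "f' v"] w f f' by simp
  moreover have "g w \<in> {a..v}"
    using PLo_less_iff[OF gc, of a w] PLo_less_iff[OF gc, of w "g' v"] w g g' by simp
  ultimately have "f (g w) = g (f w)"
    using w v t(2) s(2) f(2) g(2)
    by (intro affine_common_fixpoint_commute[of "{a..v}" f m c g n e a]) (auto simp: v_def)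
  then show thesis using that[of w] w by simp
qed

lemma PLo_commute_near_left:
  assumes H: "subgroup H PLo" and f: "f \<in> H" "f b = b" and g: "g \<in> H" "g b = b"
    and b: "0 < b" "b \<le> 1" "r < b"
  obtains w where "r < w" "w < b" "f (g w) = g (f w)"
proof -
  have fc: "f \<in> carrier PLo" and gc: "g \<in> carrier PLo" using H f g subgroup.mem_carrier by fast+
  obtain t m c where t: "t < b" "\<And>x. x \<in> {t..b} \<Longrightarrow> f x = m * x + c"
    using PLo_affine_left[OF fc b(1,2)] by metis
  obtain s n e where s: "s < b" "\<And>x. x \<in> {s..b} \<Longrightarrow> g x = n * x + e"
    using PLo_affine_left[OF gc b(1,2)] by metis
  define v where "v = max t s"
  have v: "v < b" using t s by (simp add: v_def)
  obtain f' where f': "f' \<in> H" "\<And>x. f (f' x) = x" using PLo_subgroup_inverse[OF H f(1)] by metis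
  obtain g' where g': "g' \<in> H" "\<And>x. g (g' x) = x" using PLo_subgroup_inverse[OF H g(1)] by metis
  \<comment> \<open>Here \<open>w\<close> must lie above the preimages of \<open>v\<close>, so that
    its images stay between \<open>v\<close> and \<open>b\<close>.\<close>
  have "f' v < b" "g' v < b"
    using PLo_less_iff[OF fc, of "f' v" b] PLo_less_iff[OF gc, of "g' v" b] f g f' g' v by simp_all
  then obtain w where w: "max (max r v) (max (f' v) (g' v)) < w" "w < b"
    using dense[of "max (max r v) (max (f' v) (g' v))" b] b v by auto
  have "f w \<in> {v..b}"
    using PLo_less_iff[OF fc, of w b] PLo_less_iff[OF fc, of "f' v" w] w f f' by simp
  moreover have "g w \<in> {v..b}"
    using PLo_less_iff[OF gc, of w b] PLo_less_iff[OF gc, of "g' v" w] w g g' by simp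
  ultimately have "f (g w) = g (f w)"
    using w v t(2) s(2) f(2) g(2)
    by (intro affine_common_fixpoint_commute[of "{v..b}" f m c g n e b]) (auto simp: v_def)
  then show thesis using that[of w] w by simp
qed

section \<open>Transition chains from a shared end\<close>

lemma transition_chain_if_shared_left_end:
  assumes H: "subgroup H PLo" and A: "orbital H {a<..<b}" and h: "h \<in> H"
    and B: "element_orbital h {a<..<d}" and d: "a < d" "d < b"
  shows "admits_transition_chain_of_length_two H"
proof -
  have ab: "a < b" using d by simp
  note ends = orbital_fixes_ends[OF H A ab]
  have carr: "g \<in> carrier PLo" if "g \<in> H" for g using H that subgroup.mem_carrier by fast
  note hB = element_orbital_ends[OF carr[OF h] B d(1)]
  obtain k where k: "k \<in> H" "d < k d"
    using ends(5)[OF d] PLo_subgroup_moves_both_ways(1)[OF H] by blast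
  \<comment> \<open>As \<open>k\<close> moves \<open>d\<close> to the right, its preimage
    \<open>z\<close> lies inside the orbital of \<open>h\<close> and is moved by
    \<open>h\<close>.\<close>
  obtain z where z: "k z = d" using PLo_subgroup_inverse[OF H k(1)] by metis
  have "z < d" "a < z"
    using PLo_less_iff[OF carr[OF k(1)], of z d] PLo_less_iff[OF carr[OF k(1)], of a z] z k d ends(3)[OF k(1)]
    by simp_all
  \<comment> \<open>The bound \<open>w < z\<close> gives \<open>k w < d\<close>, hence
    \<open>h (k w) < d\<close>: the fixed point of the commutator falls strictly between
    \<open>a\<close> and \<open>d\<close>.\<close>
  obtain w where w: "a < w" "w < z" "h (k w) = k (h w)"
    using PLo_commute_near_right[OF H h ends(3)[OF h] k(1) ends(3)[OF k(1)] ends(1) _ \<open>a < z\<close>]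
      ab ends(2) by auto
  obtain g where g: "g \<in> H" "g d \<noteq> d" "g (h (k w)) = h (k w)"
    using commutator_fixes_and_moves[OF H h k(1) hB(2) z hB(3)[OF \<open>a < z\<close> \<open>z < d\<close>] w(3)] by blast
  have kw: "a < k w" "k w < d"
    using PLo_less_iff[OF carr[OF k(1)]] w z ends(3)[OF k(1)] by metis+
  then have p: "a < h (k w)" "h (k w) < d"
    using PLo_less_iff[OF carr[OF h]] hB(1,2) by metis+
  obtain c e where ce: "element_orbital g {c<..<e}" "c < d" "d < e" "\<And>p. g p = p \<Longrightarrow> p \<le> c \<or> e \<le> p"
    using element_orbital_around_moved_point[OF carr[OF g(1)] _ g(2)] ends(1,2) d by auto
  \<comment> \<open>The fixed point \<open>h (k w)\<close> lies below \<open>d\<close>, hence below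
    \<open>e\<close>, so it is at most \<open>c\<close>.\<close>
  have "a < c" using ce(4)[OF g(3)] p ce(3) by linarith
  then show ?thesis
    using B ce h g(1) unfolding admits_transition_chain_of_length_two_def signed_orbitals_def by blast
qed

lemma transition_chain_if_shared_right_end:
  assumes H: "subgroup H PLo" and A: "orbital H {a<..<b}" and h: "h \<in> H"
    and B: "element_orbital h {d<..<b}" and d: "a < d" "d < b"
  shows "admits_transition_chain_of_length_two H"
proof -
  have ab: "a < b" using d by simp
  note ends = orbital_fixes_ends[OF H A ab]
  have carr: "g \<in> carrier PLo" if "g \<in> H" for g using H that subgroup.mem_carrier by fast
  note hB = element_orbital_ends[OF carr[OF h] B d(2)]
  \<comment> \<open>Now \<open>d\<close> is moved to the left, so that its preimage under
    \<open>k\<close> falls into the orbital of \<open>h\<close> on the right of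
    \<open>d\<close>.\<close>
  obtain k where k: "k \<in> H" "k d < d"
    using ends(5)[OF d] PLo_subgroup_moves_both_ways(2)[OF H] by blast
  obtain z where z: "k z = d" using PLo_subgroup_inverse[OF H k(1)] by metis
  have "d < z" "z < b"
    using PLo_less_iff[OF carr[OF k(1)], of d z] PLo_less_iff[OF carr[OF k(1)], of z b] z k d ends(4)[OF k(1)]
    by simp_all
  obtain w where w: "z < w" "w < b" "h (k w) = k (h w)"
    using PLo_commute_near_left[OF H h ends(4)[OF h] k(1) ends(4)[OF k(1)] _ ends(2) \<open>z < b\<close>]
      ab ends(1) by auto
  obtain g where g: "g \<in> H" "g d \<noteq> d" "g (h (k w)) = h (k w)"
    using commutator_fixes_and_moves[OF H h k(1) hB(1) z hB(3)[OF \<open>d < z\<close> \<open>z < b\<close>] w(3)] by blast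
  have kw: "d < k w" "k w < b"
    using PLo_less_iff[OF carr[OF k(1)]] w z ends(4)[OF k(1)] by metis+
  then have p: "d < h (k w)" "h (k w) < b"
    using PLo_less_iff[OF carr[OF h]] hB(1,2) by metis+
  obtain c e where ce: "element_orbital g {c<..<e}" "c < d" "d < e" "\<And>p. g p = p \<Longrightarrow> p \<le> c \<or> e \<le> p"
    using element_orbital_around_moved_point[OF carr[OF g(1)] _ g(2)] ends(1,2) d by auto
  \<comment> \<open>The orbital of \<open>g\<close> ends before \<open>b\<close>, so it comes first
    in the chain and that of \<open>h\<close> second.\<close>
  have "e < b" using ce(4)[OF g(3)] p ce(2) by linarith
  then show ?thesis
    using B ce h g(1) unfolding admits_transition_chain_of_length_two_def signed_orbitals_def by blast
qed

theorem lemma1p5: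
  fixes H :: "(real \<Rightarrow> real) set" and A :: "real set" and h :: "real \<Rightarrow> real"
  assumes "subgroup H PLo"
    and "orbital H A"
    and "h \<in> H"
    and "\<exists>B. element_orbital h B \<and> shares_exactly_one_end B A \<and>
             (\<forall>C. element_orbital h C \<and> C \<noteq> B \<longrightarrow> \<not> shares_end C A)"
  shows "admits_transition_chain_of_length_two H"
proof -
  obtain a b c d where ab: "a < b" "A = {a<..<b}" and cd: "c < d" "element_orbital h {c<..<d}"
    and one: "c = a \<and> d \<noteq> b \<or> c \<noteq> a \<and> d = b"
    using assms(4) unfolding shares_exactly_one_end_def by blast
  have hc: "h \<in> carrier PLo" using assms(1,3) subgroup.mem_carrier by fast
  have A: "orbital H {a<..<b}" using assms(2) ab(2) by simp
  note hab = orbital_fixes_ends(3,4)[OF assms(1) A ab(1) assms(3)]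
  note hmoves = element_orbital_ends(3)[OF hc cd(2,1)]
  \<comment> \<open>\<open>B\<close> is not assumed to lie in \<open>A\<close>; it does because \<open>h\<close> fixes both ends of \<open>A\<close>.\<close>
  from one show ?thesis
  proof
    assume l: "c = a \<and> d \<noteq> b"
    then have "d < b" using hmoves[of b] hab ab(1) by force
    then show ?thesis
      using transition_chain_if_shared_left_end[OF assms(1) A assms(3)] l cd by simp
  next
    assume r: "c \<noteq> a \<and> d = b"
    then have "a < c" using hmoves[of a] hab ab(1) by force
    then show ?thesis
      using transition_chain_if_shared_right_end[OF assms(1) A assms(3)] r cd by simp
  qed
qed

end
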